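(* Let $Q=(\tfrac13,\tfrac59,\tfrac59,\tfrac59)\in\Delta_{4,2}$ and let $M_Q^5=\mu^{-1}(Q)\subset G_{4,2}$ be the level set of the moment map $\mu:G_{4,2}\to\Delta_{4,2}$. Then $M_Q^5$ is homeomorphic to $S^3\times T^2$.
   Context: $G_{4,2}$ is the Grassmannian of 2-dimensional complex subspaces of $\mathbb{C}^4$, with Plücker coordinates $P^{ij}(L)$, $1\le i<j\le4$. $\Lambda_{ij}=e_i+e_j\in\mathbb{R}^4$; $\Delta_{4,2}=\{x\in\mathbb{R}^4:0\le x_i\le1,\ \sum x_i=2\}$. The moment map of the canonical $T^4$-action on $G_{4,2}$ is $$\mu(L)=\frac{\sum_{i<j}|P^{ij}(L)|^2\Lambda_{ij}}{\sum_{i<j}|P^{ij}(L)|^2}.$$ $T^2=S^1\times S^1$. *)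

theory Defs
  imports "HOL-Analysis.Analysis"
begin

text \<open>The unqualified constants \<open>subspace\<close>, \<open>span\<close>, \<open>independent\<close>, \<open>dim\<close> refer to real
  scalars; their versions with prefix \<open>vec\<close> refer to scalar multiplication \<open>*s\<close>, so here
  to complex scalars.\<close>

definition G42 :: "(complex^4) set set"
  where "G42 = {L. vec.subspace L \<and> vec.dim L = 2}"

definition frames42 :: "((complex^4) \<times> (complex^4)) set"
  where "frames42 = {(u, v). u \<noteq> v \<and> vec.independent {u, v}}"

definition span2 :: "(complex^4) \<times> (complex^4) \<Rightarrow> (complex^4) set"
  where "span2 p = vec.span {fst p, snd p}"

text \<open>The usual topology: the quotient topology along the map sending a frame to its span;
  see \<open>quotient_map_span2\<close> below.\<close>

definition grassmannian42 :: "(complex^4) set topology"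
  where "grassmannian42 =
    topology (\<lambda>U. U \<subseteq> G42 \<and> openin (top_of_set frames42) {p \<in> frames42. span2 p \<in> U})"

lemma span2_in_G42:
  assumes "p \<in> frames42"
  shows "span2 p \<in> G42"
proof -
  obtain u v where p: "p = (u, v)" "u \<noteq> v" "vec.independent {u, v}"
    using assms by (auto simp: frames42_def)
  then have "vec.dim (vec.span {u, v}) = card {u, v}"
    by (simp add: vec.dim_eq_card_independent)
  with p show ?thesis
    by (simp add: G42_def span2_def)
qed

lemma span2_image: "span2 ` frames42 = G42"
proof
  show "span2 ` frames42 \<subseteq> G42"
    using span2_in_G42 by blast
  show "G42 \<subseteq> span2 ` frames42"
  proof
    fix L assume "L \<in> G42"
    then have L: "vec.subspace L" "vec.dim L = 2"
      by (auto simp: G42_def)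
    obtain B where B: "B \<subseteq> L" "vec.independent B" "L \<subseteq> vec.span B" "card B = vec.dim L"
      using vec.basis_exists[of L] by blast
    then obtain u v where "B = {u, v}" "u \<noteq> v"
      using L by (metis card_2_iff)
    moreover have "vec.span B = L"
      using B L by (simp add: subset_antisym vec.span_minimal)
    ultimately have "(u, v) \<in> frames42" "span2 (u, v) = L"
      using B by (auto simp: frames42_def span2_def)
    then show "L \<in> span2 ` frames42"
      by blast
  qed
qed

lemma openin_grassmannian42:
  "openin grassmannian42 U \<longleftrightarrow>
    U \<subseteq> G42 \<and> openin (top_of_set frames42) {p \<in> frames42. span2 p \<in> U}"
proof -
  let ?P = "\<lambda>U. U \<subseteq> G42 \<and> openin (top_of_set frames42) {p \<in> frames42. span2 p \<in> U}"
  have "istopology ?P"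
    unfolding istopology_def
  proof (intro conjI allI impI)
    fix S T assume S: "?P S" and T: "?P T"
    show "S \<inter> T \<subseteq> G42"
      using S by blast
    have "{p \<in> frames42. span2 p \<in> S \<inter> T} =
        {p \<in> frames42. span2 p \<in> S} \<inter> {p \<in> frames42. span2 p \<in> T}"
      by blast
    then show "openin (top_of_set frames42) {p \<in> frames42. span2 p \<in> S \<inter> T}"
      using S T by (simp only: openin_Int)
  next
    fix K assume K: "\<forall>S\<in>K. ?P S"
    show "\<Union>K \<subseteq> G42"
      using K by blast
    have "{p \<in> frames42. span2 p \<in> \<Union>K} = (\<Union>S\<in>K. {p \<in> frames42. span2 p \<in> S})"
      by blast
    moreover have "openin (top_of_set frames42) (\<Union>S\<in>K. {p \<in> frames42. span2 p \<in> S})"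
      using K by (intro openin_Union) blast
    ultimately show "openin (top_of_set frames42) {p \<in> frames42. span2 p \<in> \<Union>K}"
      by simp
  qed
  then show ?thesis
    by (simp add: grassmannian42_def topology_inverse')
qed

lemma topspace_grassmannian42: "topspace grassmannian42 = G42"
proof -
  have "{p \<in> frames42. span2 p \<in> G42} = frames42"
    using span2_in_G42 by blast
  then have "openin grassmannian42 G42"
    by (simp add: openin_grassmannian42)
  then show ?thesis
    by (meson openin_grassmannian42 openin_subset openin_topspace subset_antisym)
qed

lemma quotient_map_span2: "quotient_map (top_of_set frames42) grassmannian42 span2"
  by (simp add: quotient_map_def topspace_grassmannian42 span2_image openin_grassmannian42)

definition plucker :: "4 \<Rightarrow> 4 \<Rightarrow> (complex^4) \<times> (complex^4) \<Rightarrow> complex"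
  where "plucker i j p = fst p $ i * snd p $ j - fst p $ j * snd p $ i"

text \<open>The index set \<open>1 \<le> i < j \<le> 4\<close> is listed explicitly, because in the numeral type the
  element \<open>4\<close> equals \<open>0\<close> and is the least element of its order.\<close>

definition pairs42 :: "(4 \<times> 4) set"
  where "pairs42 = {(1, 2), (1, 3), (1, 4), (2, 3), (2, 4), (3, 4)}"

lemma sum_pairs42:
  "(\<Sum>(i, j)\<in>pairs42. f i j) = f 1 2 + f 1 3 + f 1 4 + f 2 3 + f 2 4 + f 3 4"
  by (simp add: pairs42_def add.assoc)

definition Lambda :: "4 \<Rightarrow> 4 \<Rightarrow> real^4"
  where "Lambda i j = axis i 1 + axis j 1"

definition moment_frame :: "(complex^4) \<times> (complex^4) \<Rightarrow> real^4"
  where "moment_frame p =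
    (\<Sum>(i, j)\<in>pairs42. (cmod (plucker i j p))\<^sup>2 *\<^sub>R Lambda i j) /\<^sub>R
    (\<Sum>(i, j)\<in>pairs42. (cmod (plucker i j p))\<^sup>2)"

text \<open>Pluecker coordinates are defined up to a common nonzero factor, so the value does not
  depend on the chosen basis; see \<open>moment_map_span2\<close> below.\<close>

definition moment_map :: "(complex^4) set \<Rightarrow> real^4"
  where "moment_map L = moment_frame (SOME p. p \<in> frames42 \<and> span2 p = L)"

definition hypersimplex42 :: "(real^4) set"
  where "hypersimplex42 = {x. (\<forall>i. 0 \<le> x $ i \<and> x $ i \<le> 1) \<and> (\<Sum>i\<in>UNIV. x $ i) = 2}"

lemma plucker_sum_pos:
  assumes "p \<in> frames42"
  shows "(\<Sum>(i, j)\<in>pairs42. (cmod (plucker i j p))\<^sup>2) > 0"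
proof (rule ccontr)
  assume neg: "\<not> ?thesis"
  obtain u v where p: "p = (u, v)" and uv: "u \<noteq> v" "vec.independent {u, v}"
    using assms by (auto simp: frames42_def)
  have fin: "finite pairs42"
    by (simp add: pairs42_def)
  have "(\<Sum>x\<in>pairs42. (cmod (plucker (fst x) (snd x) p))\<^sup>2) = 0"
    using neg sum_nonneg[of pairs42 "\<lambda>x. (cmod (plucker (fst x) (snd x) p))\<^sup>2"]
    by (simp add: case_prod_unfold)
  then have "\<forall>x\<in>pairs42. plucker (fst x) (snd x) p = 0"
    using fin by (subst (asm) sum_nonneg_eq_0_iff) auto
  then have minors: "\<forall>i j. u $ i * v $ j = u $ j * v $ i"
    by (simp add: pairs42_def plucker_def p forall_4)
  have "u \<noteq> 0"
    using uv vec.dependent_zero by blast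
  then obtain i where i: "u $ i \<noteq> 0"
    by (auto simp: vec_eq_iff)
  have "v $ j = v $ i / u $ i * u $ j" for j
  proof -
    have "v $ i * u $ j = u $ i * v $ j"
      using minors by (metis mult.commute)
    then show ?thesis
      using i by simp
  qed
  then have "v = (v $ i / u $ i) *s u"
    unfolding vec_eq_iff vector_smult_component by blast
  then have "v \<in> vec.span {u}"
    unfolding vec.span_singleton by blast
  moreover have "vec.independent {v, u}" "v \<notin> {u}"
    using uv by (auto simp: insert_commute)
  ultimately show False
    by (simp add: vec.independent_insert)
qed

lemma moment_map_span2:
  assumes p: "p \<in> frames42"
  shows "moment_map (span2 p) = moment_frame p"
proof -
  define q where "q = (SOME q. q \<in> frames42 \<and> span2 q = span2 p)"
  have q: "q \<in> frames42" "span2 q = span2 p"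
    using someI[of "\<lambda>q. q \<in> frames42 \<and> span2 q = span2 p" p] p by (auto simp: q_def)
  have comb: "\<exists>a b. w = a *s fst p + b *s snd p" if w: "w \<in> span2 p" for w
  proof -
    obtain a where "w - a *s fst p \<in> vec.span {snd p}"
      using w unfolding span2_def vec.span_insert[of "fst p"] by auto
    then obtain b where "w - a *s fst p = b *s snd p"
      by (auto simp: vec.span_singleton)
    then have "w = a *s fst p + b *s snd p"
      by (simp add: algebra_simps)
    then show ?thesis
      by blast
  qed
  have "fst q \<in> span2 p" "snd q \<in> span2 p"
    unfolding q(2)[symmetric] by (simp_all add: span2_def vec.span_base)
  then obtain a b c d where
    ab: "fst q = a *s fst p + b *s snd p" and cd: "snd q = c *s fst p + d *s snd p"
    using comb by meson
  define k where "k = a * d - b * c"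
  have k: "plucker i j q = k * plucker i j p" for i j
    by (simp add: plucker_def ab cd k_def algebra_simps)
  let ?S = "\<lambda>p. \<Sum>(i, j)\<in>pairs42. (cmod (plucker i j p))\<^sup>2"
  let ?V = "\<lambda>p. \<Sum>(i, j)\<in>pairs42. (cmod (plucker i j p))\<^sup>2 *\<^sub>R Lambda i j"
  have S: "?S q = (cmod k)\<^sup>2 * ?S p"
    by (simp add: k norm_mult power_mult_distrib sum_distrib_left case_prod_unfold)
  have V: "?V q = (cmod k)\<^sup>2 *\<^sub>R ?V p"
    by (simp add: k norm_mult power_mult_distrib scaleR_sum_right case_prod_unfold)
  have "k \<noteq> 0"
    using plucker_sum_pos[OF q(1)] S by auto
  then have "moment_frame q = moment_frame p"
    by (simp add: moment_frame_def S V)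
  then show ?thesis
    by (simp add: moment_map_def q_def)
qed

lemma moment_map_in_hypersimplex42:
  assumes "L \<in> G42"
  shows "moment_map L \<in> hypersimplex42"
proof -
  obtain p where p: "p \<in> frames42" "L = span2 p"
    using assms span2_image by blast
  define S where "S = (\<Sum>(i, j)\<in>pairs42. (cmod (plucker i j p))\<^sup>2)"
  define N where "N i j = (cmod (plucker i j p))\<^sup>2" for i j
  have N: "N i j \<ge> 0" for i j
    by (simp add: N_def)
  have S: "S = N 1 2 + N 1 3 + N 1 4 + N 2 3 + N 2 4 + N 3 4"
    by (simp only: S_def N_def sum_pairs42)
  have "S > 0"
    using plucker_sum_pos[OF p(1)] by (simp add: S_def)
  have m: "moment_map L =
      (N 1 2 *\<^sub>R Lambda 1 2 + N 1 3 *\<^sub>R Lambda 1 3 + N 1 4 *\<^sub>R Lambda 1 4 +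
       N 2 3 *\<^sub>R Lambda 2 3 + N 2 4 *\<^sub>R Lambda 2 4 + N 3 4 *\<^sub>R Lambda 3 4) /\<^sub>R S"
    unfolding p(2) moment_map_span2[OF p(1)] moment_frame_def S_def[symmetric]
    unfolding sum_pairs42 N_def ..
  have c: "moment_map L $ 1 = (N 1 2 + N 1 3 + N 1 4) / S"
    "moment_map L $ 2 = (N 1 2 + N 2 3 + N 2 4) / S"
    "moment_map L $ 3 = (N 1 3 + N 2 3 + N 3 4) / S"
    "moment_map L $ 4 = (N 1 4 + N 2 4 + N 3 4) / S"
    by (simp_all add: m Lambda_def axis_def divide_inverse mult.commute)
  have "moment_map L $ 1 + moment_map L $ 2 + moment_map L $ 3 + moment_map L $ 4 = 2"
    using \<open>S > 0\<close> unfolding c add_divide_distrib[symmetric]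
    by (simp add: nonzero_divide_eq_eq) (simp add: S)
  moreover have "\<forall>i. 0 \<le> moment_map L $ i \<and> moment_map L $ i \<le> 1"
    using \<open>S > 0\<close> unfolding forall_4 c by (simp add: N) (simp add: S N)
  ultimately show ?thesis
    by (simp add: hypersimplex42_def sum_4)
qed

definition Q_point :: "real^4"
  where "Q_point = vector [1/3, 5/9, 5/9, 5/9]"

lemma Q_point_nth: "Q_point $ 1 = 1/3" "Q_point $ 2 = 5/9" "Q_point $ 3 = 5/9" "Q_point $ 4 = 5/9"
  by (simp_all add: Q_point_def vector_def)

lemma Q_point_in_hypersimplex42: "Q_point \<in> hypersimplex42"
  by (simp add: hypersimplex42_def forall_4 sum_4 Q_point_nth)

definition level_set42 :: "real^4 \<Rightarrow> (complex^4) set set"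
  where "level_set42 x = {L \<in> G42. moment_map L = x}"

end

theory Submission
  imports Defs
begin

text \<open>Write a frame \<open>(u, v)\<close> of a plane \<open>L\<close> as four vectors \<open>w i = (u $ i, v $ i)\<close> of
  \<open>\<complex>\<^sup>2\<close>, so that the Pluecker coordinates are the determinants \<open>det (w i, w j)\<close>. Over \<open>Q\<close> the
  moment equations say precisely that \<open>\<bar>P\<^sup>3\<^sup>4\<bar>\<^sup>2 - \<bar>P\<^sup>1\<^sup>2\<bar>\<^sup>2\<close>, \<open>\<bar>P\<^sup>2\<^sup>4\<bar>\<^sup>2 - \<bar>P\<^sup>1\<^sup>3\<bar>\<^sup>2\<close> and
  \<open>\<bar>P\<^sup>2\<^sup>3\<bar>\<^sup>2 - \<bar>P\<^sup>1\<^sup>4\<bar>\<^sup>2\<close> are all one ninth of \<open>\<Sum>\<bar>P\<^sup>i\<^sup>j\<bar>\<^sup>2\<close>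
  (\<open>moment_frame_eq_Q_iff\<close>). Hence \<open>w 2\<close>, \<open>w 3\<close>, \<open>w 4\<close> are pairwise independent and
  \<open>w 1 \<noteq> 0\<close>, and after a change of basis
  \<open>w 2 = (t2, 0)\<close>, \<open>w 3 = (0, t3)\<close>, \<open>w 4 = t4 (a, b)\<close>, \<open>w 1 = t1 (c, d)\<close>
  with all \<open>ti > 0\<close>, \<open>\<bar>a\<bar> = \<bar>b\<bar> = 1\<close> and \<open>(c, d)\<close> in the unit sphere of \<open>\<complex>\<^sup>2\<close>
  (\<open>generic_span2_eq_scaled_frame\<close>). The point \<open>((c, d), a, b)\<close> of \<open>S\<^sup>3 \<times> T\<^sup>2\<close> depends only
  on \<open>L\<close> and is the image of \<open>L\<close> under the homeomorphism.

  What remains is that for each \<open>((c, d), a, b)\<close> there is exactly one choice of the \<open>ti\<close>, up to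
  a common factor, that satisfies the moment equations, and that it varies continuously. With
  \<open>x = \<bar>P\<^sup>1\<^sup>2\<bar>\<^sup>2\<close>, \<open>y = \<bar>P\<^sup>1\<^sup>3\<bar>\<^sup>2\<close>, \<open>z = \<bar>P\<^sup>1\<^sup>4\<bar>\<^sup>2\<close> taken at \<open>ti = 1\<close>, let \<open>18 D\<close> be the sum of all
  \<open>\<bar>P\<^sup>i\<^sup>j\<bar>\<^sup>2\<close>. The equations allow one to write \<open>\<bar>P\<^sup>1\<^sup>2\<bar>\<^sup>2 = (A - 1) D\<close>,
  \<open>\<bar>P\<^sup>3\<^sup>4\<bar>\<^sup>2 = (A + 1) D\<close>, and likewise with \<open>B\<close> and \<open>C\<close> for the other two complementary pairs;
  then \<open>A + B + C = 9\<close>. The product of the coordinates of a complementary pair scales by the same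
  factor \<open>t1 t2 t3 t4\<close> for all three pairs, so with \<open>l = (t1 t2 t3 t4 / D)\<^sup>2\<close>
  \<open>A\<^sup>2 - 1 = l x\<close>, \<open>B\<^sup>2 - 1 = l y\<close>, \<open>C\<^sup>2 - 1 = l z\<close>.
  Everything is therefore governed by the single equation
  \<open>sqrt (1 + l x) + sqrt (1 + l y) + sqrt (1 + l z) = 9\<close>, whose left-hand side increases strictly
  in \<open>l\<close>. Its root exists, is unique and is continuous in \<open>(x, y, z)\<close> (\<open>ex1_total_sqrt\<close>,
  \<open>continuous_on_stretch\<close>), and it gives the \<open>ti\<close> back by a formula (\<open>level_frame_scaled\<close>,
  \<open>span2_level_frame\<close>). Both directions of the homeomorphism are thus explicit, and the one that
  starts at the level set is continuous because the topology there is again a quotient topology of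
  a space of frames.\<close>

section \<open>Frames and Pluecker coordinates\<close>

lemma plucker_nonzero_imp_frame:
  assumes "plucker i j p \<noteq> 0"
  shows "p \<in> frames42"
proof -
  obtain u v where p: "p = (u, v)" by fastforce
  have "u \<noteq> v" "v \<noteq> 0"
    using assms by (auto simp: p plucker_def)
  moreover have "u \<notin> vec.span {v}"
    using assms by (auto simp: p plucker_def vec.span_singleton)
  ultimately show ?thesis
    by (simp add: p frames42_def vec.independent_insert)
qed

lemma span2_iff: "w \<in> span2 p \<longleftrightarrow> (\<exists>a b. w = a *s fst p + b *s snd p)"
proof
  assume w: "w \<in> span2 p"
  obtain a where "w - a *s fst p \<in> vec.span {snd p}"
    using w unfolding span2_def vec.span_insert[of "fst p"] by auto
  then obtain b where "w - a *s fst p = b *s snd p"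
    by (auto simp: vec.span_singleton)
  then show "\<exists>a b. w = a *s fst p + b *s snd p"
    by (metis add.commute diff_add_cancel)
next
  show "\<exists>a b. w = a *s fst p + b *s snd p \<Longrightarrow> w \<in> span2 p"
    unfolding span2_def by (auto simp: vec.span_add vec.span_scale vec.span_base)
qed

lemma span2_change_basis:
  assumes "a * d - b * c \<noteq> 0"
  shows "span2 (a *s u + b *s v, c *s u + d *s v) = span2 (u, v)"
proof -
  let ?q = "(a *s u + b *s v, c *s u + d *s v)"
  have sub: "span2 (e *s u + f *s v, g *s u + h *s v) \<subseteq> span2 (u, v)" for e f g h u v
    unfolding span2_def
    by (rule vec.span_minimal) (auto simp: vec.span_add vec.span_scale vec.span_base)
  let ?k = "a * d - b * c"
  have "u = (d / ?k) *s fst ?q + (- b / ?k) *s snd ?q" "v = (- c / ?k) *s fst ?q + (a / ?k) *s snd ?q"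
    using assms by (simp_all add: vec_eq_iff divide_simps) (simp_all add: algebra_simps)
  then have "span2 (u, v) \<subseteq> span2 ?q"
    by (metis sub prod.collapse)
  with sub show ?thesis by blast
qed

lemma plucker_change_frame:
  assumes "p \<in> frames42" "q \<in> frames42" "span2 q = span2 p"
  obtains k where "k \<noteq> 0" "\<And>i j. plucker i j q = k * plucker i j p"
proof -
  have "fst q \<in> span2 q" "snd q \<in> span2 q"
    by (simp_all add: span2_def vec.span_base)
  then obtain a b c d where
    ab: "fst q = a *s fst p + b *s snd p" and cd: "snd q = c *s fst p + d *s snd p"
    using assms(3) span2_iff by metis
  have k: "plucker i j q = (a * d - b * c) * plucker i j p" for i j
    by (simp add: plucker_def ab cd algebra_simps)
  moreover have "a * d - b * c \<noteq> 0"
    using plucker_sum_pos[OF assms(2)] by (auto simp: k)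
  ultimately show thesis using that by blast
qed

text \<open>The coordinates of \<open>Q\<close> satisfy \<open>Q\<^sub>3 + Q\<^sub>4 - 1 = Q\<^sub>2 + Q\<^sub>4 - 1 = Q\<^sub>2 + Q\<^sub>3 - 1 = 1/9\<close>, and on the
  moment side \<open>\<mu>\<^sub>i + \<mu>\<^sub>j - 1\<close> is the difference of \<open>\<bar>P\<^sup>i\<^sup>j\<bar>\<^sup>2\<close> and its counterpart for the complementary
  pair, divided by the sum of all six. In this form the equations decouple into the three
  splittings of \<open>{1, 2, 3, 4}\<close>
  into two pairs.\<close>

lemma moment_frame_eq_Q_iff:
  fixes p
  defines "N \<equiv> \<lambda>i j. (cmod (plucker i j p))\<^sup>2"
  defines "S \<equiv> N 1 2 + N 1 3 + N 1 4 + N 2 3 + N 2 4 + N 3 4"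
  assumes p: "p \<in> frames42"
  shows "moment_frame p = Q_point \<longleftrightarrow>
    N 3 4 - N 1 2 = S / 9 \<and> N 2 4 - N 1 3 = S / 9 \<and> N 2 3 - N 1 4 = S / 9"
proof -
  have S: "S = (\<Sum>(i, j)\<in>pairs42. (cmod (plucker i j p))\<^sup>2)"
    by (simp only: S_def N_def sum_pairs42)
  have "S > 0"
    using plucker_sum_pos[OF p] by (simp add: S)
  have m: "moment_frame p =
      (N 1 2 *\<^sub>R Lambda 1 2 + N 1 3 *\<^sub>R Lambda 1 3 + N 1 4 *\<^sub>R Lambda 1 4 +
       N 2 3 *\<^sub>R Lambda 2 3 + N 2 4 *\<^sub>R Lambda 2 4 + N 3 4 *\<^sub>R Lambda 3 4) /\<^sub>R S"
    unfolding moment_frame_def S[symmetric]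
    unfolding sum_pairs42 N_def ..
  have c: "moment_frame p $ 1 = (N 1 2 + N 1 3 + N 1 4) / S"
    "moment_frame p $ 2 = (N 1 2 + N 2 3 + N 2 4) / S"
    "moment_frame p $ 3 = (N 1 3 + N 2 3 + N 3 4) / S"
    "moment_frame p $ 4 = (N 1 4 + N 2 4 + N 3 4) / S"
    by (simp_all add: m Lambda_def axis_def divide_inverse mult.commute)
  show ?thesis
    unfolding vec_eq_iff forall_4 c Q_point_nth using \<open>S > 0\<close>
    by (simp add: field_simps) (auto simp: S_def)
qed

section \<open>The scalar equation that fixes the torus scaling\<close>

definition total_sqrt :: "real \<Rightarrow> real \<times> real \<times> real \<Rightarrow> real"
  where "total_sqrt l = (\<lambda>(x, y, z). sqrt (1 + l * x) + sqrt (1 + l * y) + sqrt (1 + l * z))"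

definition nonzero_weights :: "(real \<times> real \<times> real) set"
  where "nonzero_weights = {(x, y, z). 0 \<le> x \<and> 0 \<le> y \<and> 0 \<le> z \<and> 0 < x + y + z}"

lemma total_sqrt_strict_mono:
  assumes "w \<in> nonzero_weights" "0 \<le> l" "l < m"
  shows "total_sqrt l w < total_sqrt m w"
proof -
  obtain x y z where w: "w = (x, y, z)" by (metis prod_cases3)
  have le: "sqrt (1 + l * x) \<le> sqrt (1 + m * x)" if "0 \<le> x" for x
    using assms that by (simp add: mult_right_mono)
  have less: "sqrt (1 + l * x) < sqrt (1 + m * x)" if "0 < x" for x
    using assms that by simp
  have "0 \<le> x" "0 \<le> y" "0 \<le> z" "0 < x \<or> 0 < y \<or> 0 < z"
    using assms by (auto simp: nonzero_weights_def w)
  then show ?thesis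
    using le[of x] le[of y] le[of z] less[of x] less[of y] less[of z]
    unfolding total_sqrt_def w case_prod_conv by linarith
qed

text \<open>Existence is by the intermediate value theorem: the sum is 3 at 0, and its square is at least
  \<open>3 + m (x + y + z)\<close> at \<open>m\<close>, which reaches \<open>9\<^sup>2\<close> once \<open>m (x + y + z) \<ge> 78\<close>.\<close>

lemma ex1_total_sqrt:
  assumes "w \<in> nonzero_weights"
  shows "\<exists>!l. 0 \<le> l \<and> total_sqrt l w = 9"
proof -
  obtain x y z where w: "w = (x, y, z)" by (metis prod_cases3)
  have nn: "0 \<le> x" "0 \<le> y" "0 \<le> z" and pos: "0 < x + y + z"
    using assms by (auto simp: nonzero_weights_def w)
  define m where "m = 78 / (x + y + z)"
  have m: "0 \<le> m" "m * (x + y + z) = 78"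
    using pos by (simp_all add: m_def del: distrib_left_numeral)
  have "total_sqrt 0 w \<le> 9"
    by (simp add: w total_sqrt_def)
  moreover have "9 \<le> total_sqrt m w"
  proof -
    define a b c where "a = sqrt (1 + m * x)" and "b = sqrt (1 + m * y)" and "c = sqrt (1 + m * z)"
    have "a \<ge> 0" "b \<ge> 0" "c \<ge> 0" "a\<^sup>2 = 1 + m * x" "b\<^sup>2 = 1 + m * y" "c\<^sup>2 = 1 + m * z"
      using nn m by (simp_all add: a_def b_def c_def)
    moreover from this have "a * b \<ge> 0" "a * c \<ge> 0" "b * c \<ge> 0" by simp_all
    moreover have "(a + b + c)\<^sup>2 = a\<^sup>2 + b\<^sup>2 + c\<^sup>2 + 2 * (a * b) + 2 * (a * c) + 2 * (b * c)"
      by (simp add: power2_eq_square algebra_simps)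
    moreover have "m * x + m * y + m * z = 78"
      using m(2) by (simp add: distrib_left)
    ultimately have "81 \<le> (a + b + c)\<^sup>2" "0 \<le> a + b + c"
      by linarith+
    then have "9\<^sup>2 \<le> (a + b + c)\<^sup>2" "0 \<le> a + b + c"
      by simp_all
    then have "9 \<le> a + b + c"
      using power2_le_imp_le by blast
    then show ?thesis by (simp add: w total_sqrt_def a_def b_def c_def)
  qed
  moreover have "continuous_on {0..m} (\<lambda>l. total_sqrt l w)"
    unfolding w total_sqrt_def by (auto intro!: continuous_intros)
  ultimately obtain l where "0 \<le> l" "total_sqrt l w = 9"
    using IVT'[of "\<lambda>l. total_sqrt l w" 0 9 m] m(1) by auto
  then show ?thesis
    by (metis assms less_irrefl linorder_neqE_linordered_idom total_sqrt_strict_mono)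
qed

definition stretch :: "real \<times> real \<times> real \<Rightarrow> real"
  where "stretch w = (THE l. 0 \<le> l \<and> total_sqrt l w = 9)"

lemma stretch:
  assumes "w \<in> nonzero_weights"
  shows "0 \<le> stretch w" "total_sqrt (stretch w) w = 9"
  using theI'[OF ex1_total_sqrt[OF assms]] by (simp_all add: stretch_def)

lemma stretch_unique:
  assumes "w \<in> nonzero_weights" "0 \<le> l" "total_sqrt l w = 9"
  shows "stretch w = l"
  using ex1_total_sqrt[OF assms(1)] assms stretch by blast

lemma stretch_pos:
  assumes "w \<in> nonzero_weights"
  shows "0 < stretch w"
proof -
  have "stretch w \<noteq> 0"
    using stretch(2)[OF assms] by (auto simp: total_sqrt_def split: prod.splits)
  with stretch(1)[OF assms] show ?thesis by simp
qed

lemma stretch_less_iff: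
  assumes "w \<in> nonzero_weights" "0 \<le> a"
  shows "stretch w < a \<longleftrightarrow> 9 < total_sqrt a w" "a < stretch w \<longleftrightarrow> total_sqrt a w < 9"
  using total_sqrt_strict_mono[OF assms(1)] stretch[OF assms(1)] assms(2)
  by (smt (verit))+

text \<open>By monotonicity, \<open>stretch w\<close> lies on a given side of \<open>a\<close> exactly when \<open>total_sqrt a w\<close> lies on the
  opposite side of 9, and this is an open condition on \<open>w\<close>.\<close>

lemma continuous_on_stretch: "continuous_on nonzero_weights stretch"
  unfolding continuous_on_def
proof
  fix w assume w: "w \<in> nonzero_weights"
  have cont: "((\<lambda>v. total_sqrt a v) \<longlongrightarrow> total_sqrt a w) (at w within nonzero_weights)" for a
    unfolding total_sqrt_def case_prod_unfold by (intro tendsto_intros)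
  have ev: "\<forall>\<^sub>F v in at w within nonzero_weights. v \<in> nonzero_weights"
    by (simp add: eventually_at_filter)
  show "(stretch \<longlongrightarrow> stretch w) (at w within nonzero_weights)"
  proof (rule order_tendstoI)
    fix a assume a: "a < stretch w"
    show "\<forall>\<^sub>F v in at w within nonzero_weights. a < stretch v"
    proof (cases "0 \<le> a")
      case True
      then have "\<forall>\<^sub>F v in at w within nonzero_weights. total_sqrt a v < 9"
        using a cont order_tendstoD(2) stretch_less_iff(2) w by blast
      then show ?thesis
        using ev by eventually_elim (simp add: stretch_less_iff True)
    next
      case False
      show ?thesis
        using ev by eventually_elim (use False stretch(1) in fastforce)
    qed
  next
    fix a assume a: "stretch w < a"
    then have "0 \<le> a"
      using stretch(1)[OF w] by simp
    then have "\<forall>\<^sub>F v in at w within nonzero_weights. 9 < total_sqrt a v"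
      using a cont order_tendstoD(1) stretch_less_iff(1) w by blast
    then show "\<forall>\<^sub>F v in at w within nonzero_weights. stretch v < a"
      using ev by eventually_elim (simp add: stretch_less_iff \<open>0 \<le> a\<close>)
  qed
qed

section \<open>The parameter space and its frames\<close>

definition real4 :: "complex \<Rightarrow> complex \<Rightarrow> real^4"
  where "real4 c d = vector [Re c, Im c, Re d, Im d]"

definition fst4 :: "real^4 \<Rightarrow> complex"
  where "fst4 y = Complex (y $ 1) (y $ 2)"

definition snd4 :: "real^4 \<Rightarrow> complex"
  where "snd4 y = Complex (y $ 3) (y $ 4)"

lemma vector4_nth [simp]:
  "vector [w, x, y, z] $ (1::4) = w" "vector [w, x, y, z] $ (2::4) = x"
  "vector [w, x, y, z] $ (3::4) = y" "vector [w, x, y, z] $ (4::4) = z"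
  by (simp_all add: vector_def)

lemma continuous_on_vector4 [continuous_intros]:
  fixes f g h k :: "'a::topological_space \<Rightarrow> 'b::real_normed_vector"
  assumes "continuous_on S f" "continuous_on S g" "continuous_on S h" "continuous_on S k"
  shows "continuous_on S (\<lambda>x. vector [f x, g x, h x, k x] :: 'b^4)"
proof -
  have "continuous_on S (\<lambda>x. vector [f x, g x, h x, k x] $ (i::4))" for i
    using exhaust_4[of i] assms by auto
  then have "continuous_on S (\<lambda>x. \<chi> i::4. vector [f x, g x, h x, k x] $ i)"
    by (intro continuous_on_vec_lambda)
  then show ?thesis by simp
qed

lemma continuous_on_real4 [continuous_intros]:
  assumes "continuous_on S f" "continuous_on S g"
  shows "continuous_on S (\<lambda>x. real4 (f x) (g x))"
  unfolding real4_def by (intro continuous_intros assms)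

lemma fst4_real4 [simp]: "fst4 (real4 c d) = c" "snd4 (real4 c d) = d"
  by (simp_all add: fst4_def snd4_def real4_def)

lemma real4_fst4_snd4: "real4 (fst4 y) (snd4 y) = y"
  by (simp add: vec_eq_iff forall_4 fst4_def snd4_def real4_def)

lemma fst4_0 [simp]: "fst4 0 = 0" "snd4 0 = 0"
  by (simp_all add: fst4_def snd4_def complex_eq_iff)

lemma real4_scale: "real4 (of_real r * c) (of_real r * d) = r *\<^sub>R real4 c d"
  by (simp add: vec_eq_iff forall_4 real4_def)

lemma norm_fst4_snd4: "(cmod (fst4 y))\<^sup>2 + (cmod (snd4 y))\<^sup>2 = (norm y)\<^sup>2"
  by (simp add: fst4_def snd4_def cmod_power2 norm_vec_def L2_set_def sum_4)

lemma fst4_sgn: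
  "of_real (norm y) * fst4 (sgn y) = fst4 y" "of_real (norm y) * snd4 (sgn y) = snd4 y"
  by (cases "y = 0"; simp add: fst4_def snd4_def sgn_div_norm complex_eq_iff)+

type_synonym params = "(real^4) \<times> complex \<times> complex"

definition S3T2 :: "params set"
  where "S3T2 = sphere 0 1 \<times> sphere 0 1 \<times> sphere 0 1"

definition scaled_frame :: "real \<Rightarrow> real \<Rightarrow> real \<Rightarrow> real \<Rightarrow> params \<Rightarrow> (complex^4) \<times> (complex^4)"
  where "scaled_frame t1 t2 t3 t4 = (\<lambda>(y, a, b).
    (vector [of_real t1 * fst4 y, of_real t2, 0, of_real t4 * a],
     vector [of_real t1 * snd4 y, 0, of_real t3, of_real t4 * b]))"

text \<open>The squared moduli of \<open>P\<^sup>1\<^sup>2\<close>, \<open>P\<^sup>1\<^sup>3\<close>, \<open>P\<^sup>1\<^sup>4\<close> for \<open>scaled_frame 1 1 1 1\<close>. The other three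
  coordinates of that frame have modulus 1.\<close>

definition weight :: "params \<Rightarrow> real \<times> real \<times> real"
  where "weight = (\<lambda>(y, a, b).
    ((cmod (snd4 y))\<^sup>2, (cmod (fst4 y))\<^sup>2, (cmod (fst4 y * b - a * snd4 y))\<^sup>2))"

text \<open>The four scale factors satisfy \<open>t1\<^sup>2 t2\<^sup>2 x = (A - 1) D\<close>, \<open>t3\<^sup>2 t4\<^sup>2 = (A + 1) D\<close> and the
  analogous identities for \<open>B\<close> and \<open>C\<close>, where \<open>D = (A + 1) (B + 1) (C + 1)\<close>.\<close>

definition level_frame :: "params \<Rightarrow> (complex^4) \<times> (complex^4)"
  where "level_frame q =
    (let w = weight q; l = stretch w;
         A = sqrt (1 + l * fst w); B = sqrt (1 + l * fst (snd w)); C = sqrt (1 + l * snd (snd w))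
     in scaled_frame (sqrt l) (sqrt ((B + 1) * (C + 1))) (sqrt ((A + 1) * (C + 1)))
          (sqrt ((A + 1) * (B + 1))) q)"

text \<open>In the basis \<open>w 2\<close>, \<open>w 3\<close> of \<open>\<complex>\<^sup>2\<close>, Cramer's rule gives \<open>w 4 = (a, b)\<close> and \<open>w 1 = (c, d)\<close>. Stretching
  the two basis vectors by \<open>\<bar>a\<bar>\<close> and \<open>\<bar>b\<bar>\<close> makes both entries of \<open>w 4\<close> unimodular and turns
  \<open>w 1\<close> into \<open>(c / \<bar>a\<bar>, d / \<bar>b\<bar>)\<close>, which is normalised at the end.\<close>

definition coords :: "(complex^4) \<times> (complex^4) \<Rightarrow> params"
  where "coords p =
    (let a = - plucker 3 4 p / plucker 2 3 p; b = plucker 2 4 p / plucker 2 3 p;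
         c = plucker 1 3 p / plucker 2 3 p; d = - plucker 1 2 p / plucker 2 3 p
     in (sgn (real4 (c / of_real (cmod a)) (d / of_real (cmod b))), sgn a, sgn b))"

definition generic_frames :: "((complex^4) \<times> (complex^4)) set"
  where "generic_frames = {p. plucker 2 3 p \<noteq> 0 \<and> plucker 2 4 p \<noteq> 0 \<and> plucker 3 4 p \<noteq> 0 \<and>
    (plucker 1 2 p \<noteq> 0 \<or> plucker 1 3 p \<noteq> 0)}"

lemma generic_frames_subset: "generic_frames \<subseteq> frames42"
  unfolding generic_frames_def using plucker_nonzero_imp_frame by blast

lemma plucker_scaled_frame:
  "plucker 1 2 (scaled_frame t1 t2 t3 t4 (y, a, b)) = - of_real (t1 * t2) * snd4 y"
  "plucker 1 3 (scaled_frame t1 t2 t3 t4 (y, a, b)) = of_real (t1 * t3) * fst4 y"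
  "plucker 1 4 (scaled_frame t1 t2 t3 t4 (y, a, b)) =
     of_real (t1 * t4) * (fst4 y * b - a * snd4 y)"
  "plucker 2 3 (scaled_frame t1 t2 t3 t4 (y, a, b)) = of_real (t2 * t3)"
  "plucker 2 4 (scaled_frame t1 t2 t3 t4 (y, a, b)) = of_real (t2 * t4) * b"
  "plucker 3 4 (scaled_frame t1 t2 t3 t4 (y, a, b)) = - of_real (t3 * t4) * a"
  by (simp_all add: plucker_def scaled_frame_def algebra_simps)

lemma weight_nonzero:
  assumes "q \<in> S3T2"
  shows "weight q \<in> nonzero_weights"
proof -
  obtain y a b where q: "q = (y, a, b)" by (metis prod_cases3)
  have "(cmod (fst4 y))\<^sup>2 + (cmod (snd4 y))\<^sup>2 = 1"
    using assms by (simp add: q S3T2_def norm_fst4_snd4)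
  moreover have "0 \<le> (cmod (fst4 y * b - a * snd4 y))\<^sup>2" by simp
  ultimately have "0 < (cmod (snd4 y))\<^sup>2 + (cmod (fst4 y))\<^sup>2 + (cmod (fst4 y * b - a * snd4 y))\<^sup>2"
    by linarith
  then show ?thesis
    by (simp add: q nonzero_weights_def weight_def)
qed

section \<open>Planes over Q and their normal form\<close>

lemma moment_scaled_frame:
  assumes q: "q \<in> S3T2" and pos: "0 < t1" "0 < t2" "0 < t3" "0 < t4" and w: "weight q = (x, y, z)"
  defines "S \<equiv> x * (t1\<^sup>2 * t2\<^sup>2) + y * (t1\<^sup>2 * t3\<^sup>2) + z * (t1\<^sup>2 * t4\<^sup>2)
    + t2\<^sup>2 * t3\<^sup>2 + t2\<^sup>2 * t4\<^sup>2 + t3\<^sup>2 * t4\<^sup>2"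
  shows "moment_frame (scaled_frame t1 t2 t3 t4 q) = Q_point \<longleftrightarrow>
    t3\<^sup>2 * t4\<^sup>2 - x * (t1\<^sup>2 * t2\<^sup>2) = S / 9 \<and> t2\<^sup>2 * t4\<^sup>2 - y * (t1\<^sup>2 * t3\<^sup>2) = S / 9 \<and>
    t2\<^sup>2 * t3\<^sup>2 - z * (t1\<^sup>2 * t4\<^sup>2) = S / 9"
proof -
  obtain v a b where qe: "q = (v, a, b)" by (metis prod_cases3)
  let ?p = "scaled_frame t1 t2 t3 t4 (v, a, b)"
  have ab: "cmod a = 1" "cmod b = 1"
    using q by (simp_all add: qe S3T2_def)
  have xyz: "x = (cmod (snd4 v))\<^sup>2" "y = (cmod (fst4 v))\<^sup>2" "z = (cmod (fst4 v * b - a * snd4 v))\<^sup>2"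
    using w by (simp_all add: weight_def qe)
  have N: "(cmod (plucker 1 2 ?p))\<^sup>2 = x * (t1\<^sup>2 * t2\<^sup>2)" "(cmod (plucker 1 3 ?p))\<^sup>2 = y * (t1\<^sup>2 * t3\<^sup>2)"
    "(cmod (plucker 1 4 ?p))\<^sup>2 = z * (t1\<^sup>2 * t4\<^sup>2)" "(cmod (plucker 2 3 ?p))\<^sup>2 = t2\<^sup>2 * t3\<^sup>2"
    "(cmod (plucker 2 4 ?p))\<^sup>2 = t2\<^sup>2 * t4\<^sup>2" "(cmod (plucker 3 4 ?p))\<^sup>2 = t3\<^sup>2 * t4\<^sup>2"
    unfolding plucker_scaled_frame norm_mult norm_minus_cancel norm_of_real ab xyz
    by (simp_all add: power_mult_distrib mult_ac)
  have "plucker 2 3 ?p \<noteq> 0"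
    using pos by (simp add: plucker_scaled_frame)
  then have "?p \<in> frames42"
    by (rule plucker_nonzero_imp_frame)
  from moment_frame_eq_Q_iff[OF this] show ?thesis
    unfolding qe N S_def .
qed

lemma scaled_frame_generic:
  assumes "q \<in> S3T2" "0 < t1" "0 < t2" "0 < t3" "0 < t4"
  shows "scaled_frame t1 t2 t3 t4 q \<in> generic_frames"
proof -
  obtain v a b where q: "q = (v, a, b)" by (metis prod_cases3)
  have "a \<noteq> 0" "b \<noteq> 0" "v \<noteq> 0"
    using assms by (auto simp: q S3T2_def)
  moreover from this have "fst4 v \<noteq> 0 \<or> snd4 v \<noteq> 0"
    using norm_fst4_snd4[of v] by auto
  ultimately show ?thesis
    using assms by (auto simp: q generic_frames_def plucker_scaled_frame)
qed

lemma coords_scaled_frame: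
  assumes "q \<in> S3T2" "0 < t1" "0 < t2" "0 < t3" "0 < t4"
  shows "coords (scaled_frame t1 t2 t3 t4 q) = q"
proof -
  obtain v a b where q: "q = (v, a, b)" by (metis prod_cases3)
  have ab: "cmod a = 1" "cmod b = 1" and v: "norm v = 1"
    using assms by (simp_all add: q S3T2_def)
  let ?p = "scaled_frame t1 t2 t3 t4 (v, a, b)"
  have 1: "- plucker 3 4 ?p / plucker 2 3 ?p = (t4 / t2) *\<^sub>R a"
    "plucker 2 4 ?p / plucker 2 3 ?p = (t4 / t3) *\<^sub>R b"
    and 2: "plucker 1 3 ?p / plucker 2 3 ?p = of_real (t1 / t2) * fst4 v"
    "- plucker 1 2 ?p / plucker 2 3 ?p = of_real (t1 / t3) * snd4 v"
    using assms by (simp_all add: plucker_scaled_frame scaleR_conv_of_real)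
  have 3: "of_real (t1 / t2) * fst4 v / of_real (cmod ((t4 / t2) *\<^sub>R a)) = of_real (t1 / t4) * fst4 v"
    "of_real (t1 / t3) * snd4 v / of_real (cmod ((t4 / t3) *\<^sub>R b)) = of_real (t1 / t4) * snd4 v"
    using assms ab by simp_all
  have "sgn a = a" "sgn b = b" "sgn v = v"
    using ab v by (simp_all add: sgn_div_norm)
  moreover have "sgn (t4 / t2) = (1::real)" "sgn (t4 / t3) = (1::real)" "sgn (t1 / t4) = (1::real)"
    using assms by simp_all
  ultimately show ?thesis
    unfolding q coords_def Let_def 1 2 3 real4_scale real4_fst4_snd4 sgn_scaleR by simp
qed

text \<open>Every plane in which the coordinates make sense is recovered from them up to a positive scaling of
  the four coordinate axes of \<open>\<complex>\<^sup>4\<close>, with \<open>t4\<close> normalised to 1.\<close>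

lemma generic_span2_eq_scaled_frame:
  assumes "p \<in> generic_frames"
  obtains t1 t2 t3 t4 where "0 < t1" "0 < t2" "0 < t3" "0 < t4"
    "span2 (scaled_frame t1 t2 t3 t4 (coords p)) = span2 p"
proof -
  define u v where "u = fst p" and "v = snd p"
  define a b c d where "a = - plucker 3 4 p / plucker 2 3 p" and "b = plucker 2 4 p / plucker 2 3 p"
    and "c = plucker 1 3 p / plucker 2 3 p" and "d = - plucker 1 2 p / plucker 2 3 p"
  define r s :: complex where "r = of_real (cmod a)" and "s = of_real (cmod b)"
  define y where "y = real4 (c / r) (d / s)"
  have P: "plucker 2 3 p \<noteq> 0"
    and rs: "a \<noteq> 0" "b \<noteq> 0" "r \<noteq> 0" "s \<noteq> 0" and cd: "c \<noteq> 0 \<or> d \<noteq> 0"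
    using assms by (auto simp: generic_frames_def a_def b_def c_def d_def r_def s_def)
  have coords: "coords p = (sgn y, a / r, b / s)"
    by (simp add: coords_def Let_def a_def b_def c_def d_def r_def s_def y_def sgn_eq)
  have y: "y \<noteq> 0"
  proof
    assume "y = 0"
    then have "fst4 y = 0" "snd4 y = 0" by simp_all
    with rs cd show False by (simp add: y_def)
  qed
  define D where "D = plucker 2 3 p"
  have D: "D \<noteq> 0" "D = u $ 2 * v $ 3 - u $ 3 * v $ 2"
    using P by (simp_all add: D_def plucker_def u_def v_def)
  \<comment> \<open>The change of basis is the inverse of the matrix with rows \<open>\<bar>a\<bar> w 2\<close> and \<open>\<bar>b\<bar> w 3\<close>.\<close>
  let ?f = "scaled_frame (norm y) (1 / cmod a) (1 / cmod b) 1 (coords p)"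
  have f: "?f = ((v $ 3 / (D * r)) *s u + (- u $ 3 / (D * r)) *s v,
                 (- v $ 2 / (D * s)) *s u + (u $ 2 / (D * s)) *s v)" (is "_ = ?g")
  proof -
    have "?f = (vector [c / r, 1 / r, 0, a / r], vector [d / s, 0, 1 / s, b / s])"
      unfolding coords scaled_frame_def case_prod_conv fst4_sgn
      by (simp add: y_def r_def s_def)
    also have "\<dots> = ?g"
      using D(1) rs unfolding a_def b_def c_def d_def D_def[symmetric]
      unfolding vec_eq_iff forall_4 prod_eq_iff
      by (simp add: field_simps) (simp add: D(2) plucker_def u_def v_def algebra_simps)
    finally show ?thesis .
  qed
  have "v $ 3 / (D * r) * (u $ 2 / (D * s)) - (- u $ 3 / (D * r)) * (- v $ 2 / (D * s)) = 1 / (D * r * s)"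
    using D(1) rs by (simp add: field_simps) (simp add: D(2) algebra_simps)
  then have "span2 ?f = span2 (u, v)"
    unfolding f using D(1) rs by (intro span2_change_basis) simp
  then have "span2 ?f = span2 p"
    by (simp add: u_def v_def)
  then show thesis
    using that y rs by (metis zero_less_norm_iff zero_less_divide_1_iff zero_less_one)
qed

text \<open>\<open>P\<^sup>2\<^sup>3\<close>, \<open>P\<^sup>2\<^sup>4\<close>, \<open>P\<^sup>3\<^sup>4\<close> strictly dominate their complementary coordinates. If
  \<open>P\<^sup>1\<^sup>2\<close> and \<open>P\<^sup>1\<^sup>3\<close> both vanished, the Pluecker relation would force \<open>P\<^sup>1\<^sup>4 = 0\<close> as well, and the
  first moment coordinate would be 0 instead of \<open>1/3\<close>.\<close>

lemma level_imp_generic: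
  assumes p: "p \<in> frames42" and Q: "moment_frame p = Q_point"
  shows "p \<in> generic_frames"
proof -
  define N where "N i j = (cmod (plucker i j p))\<^sup>2" for i j
  define S where "S = N 1 2 + N 1 3 + N 1 4 + N 2 3 + N 2 4 + N 3 4"
  have nn: "N i j \<ge> 0" for i j
    by (simp add: N_def)
  have "S > 0"
    using plucker_sum_pos[OF p] unfolding sum_pairs42 by (simp add: S_def N_def)
  have eq: "N 3 4 - N 1 2 = S / 9" "N 2 4 - N 1 3 = S / 9" "N 2 3 - N 1 4 = S / 9"
    using moment_frame_eq_Q_iff[OF p] Q by (simp_all add: N_def S_def)
  have "N 3 4 > 0" "N 2 4 > 0" "N 2 3 > 0"
    using eq nn[of 1 2] nn[of 1 3] nn[of 1 4] \<open>S > 0\<close> by linarith+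
  then have ne: "plucker 3 4 p \<noteq> 0" "plucker 2 4 p \<noteq> 0" "plucker 2 3 p \<noteq> 0"
    by (auto simp: N_def)
  have "plucker 1 4 p * plucker 2 3 p = plucker 1 3 p * plucker 2 4 p - plucker 1 2 p * plucker 3 4 p"
    by (simp add: plucker_def algebra_simps)
  then have "plucker 1 4 p = 0" if "plucker 1 2 p = 0" "plucker 1 3 p = 0"
    using that ne by simp
  moreover have "N 1 2 + N 1 3 + N 1 4 > 0"
    using eq \<open>S > 0\<close> S_def by linarith
  ultimately have "plucker 1 2 p \<noteq> 0 \<or> plucker 1 3 p \<noteq> 0"
    by (auto simp: N_def)
  with ne show ?thesis
    by (simp add: generic_frames_def)
qed

lemma coords_in_S3T2:
  assumes "p \<in> generic_frames"
  shows "coords p \<in> S3T2"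
proof -
  have "real4 c d \<noteq> 0" if "c \<noteq> 0 \<or> d \<noteq> 0" for c d
    using that fst4_0 fst4_real4 by metis
  with assms show ?thesis
    by (auto simp: coords_def Let_def generic_frames_def S3T2_def norm_sgn norm_divide sgn_divide)
qed

text \<open>A change of basis multiplies all Pluecker coordinates by the same factor, and \<open>coords\<close> only involves
  their ratios.\<close>

lemma coords_span2:
  assumes "p \<in> frames42" "q \<in> frames42" "span2 q = span2 p"
  shows "coords q = coords p"
proof -
  obtain k where "k \<noteq> 0" "\<And>i j. plucker i j q = k * plucker i j p"
    using plucker_change_frame[OF assms] by blast
  then show ?thesis
    by (simp add: coords_def)
qed

text \<open>The existence half. Complementary squared moduli \<open>(A \<plusminus> 1) D\<close> differ by \<open>2 D\<close>, and the sum of all six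
  is \<open>2 (A + B + C) D = 18 D\<close>, so the moment equations reduce to \<open>A + B + C = 9\<close>.\<close>

lemma level_frame_scaled:
  assumes "q \<in> S3T2"
  obtains t1 t2 t3 t4 where "0 < t1" "0 < t2" "0 < t3" "0 < t4"
    "level_frame q = scaled_frame t1 t2 t3 t4 q" "moment_frame (level_frame q) = Q_point"
proof -
  obtain x y z where w: "weight q = (x, y, z)" by (metis prod_cases3)
  have wt: "(x, y, z) \<in> nonzero_weights"
    using weight_nonzero[OF assms] by (simp add: w)
  then have nn: "0 \<le> x" "0 \<le> y" "0 \<le> z" by (auto simp: nonzero_weights_def)
  define l where "l = stretch (x, y, z)"
  have l: "0 < l" "total_sqrt l (x, y, z) = 9"
    using stretch[OF wt] stretch_pos[OF wt] by (simp_all add: l_def)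
  define A B C where "A = sqrt (1 + l * x)" and "B = sqrt (1 + l * y)" and "C = sqrt (1 + l * z)"
  have sum: "A + B + C = 9"
    using l by (simp add: total_sqrt_def A_def B_def C_def)
  have sq: "x * l = A\<^sup>2 - 1" "y * l = B\<^sup>2 - 1" "z * l = C\<^sup>2 - 1"
    using nn l by (simp_all add: A_def B_def C_def)
  have pos: "0 < A + 1" "0 < B + 1" "0 < C + 1"
    using nn l by (simp_all add: A_def B_def C_def add_nonneg_pos)
  let ?t1 = "sqrt l" and ?t2 = "sqrt ((B + 1) * (C + 1))" and ?t3 = "sqrt ((A + 1) * (C + 1))"
    and ?t4 = "sqrt ((A + 1) * (B + 1))"
  have lf: "level_frame q = scaled_frame ?t1 ?t2 ?t3 ?t4 q"
    by (simp add: level_frame_def w Let_def A_def B_def C_def l_def)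
  have tpos: "0 < ?t1" "0 < ?t2" "0 < ?t3" "0 < ?t4"
    using pos l by simp_all
  have t: "?t1\<^sup>2 = l" "?t2\<^sup>2 = (B + 1) * (C + 1)" "?t3\<^sup>2 = (A + 1) * (C + 1)"
    "?t4\<^sup>2 = (A + 1) * (B + 1)"
    using pos l by simp_all
  define D where "D = (A + 1) * (B + 1) * (C + 1)"
  have N: "x * (l * ((B + 1) * (C + 1))) = (A - 1) * D" "y * (l * ((A + 1) * (C + 1))) = (B - 1) * D"
    "z * (l * ((A + 1) * (B + 1))) = (C - 1) * D"
    unfolding mult.assoc[symmetric] sq by (simp_all add: D_def power2_eq_square algebra_simps)
  have N': "(B + 1) * (C + 1) * ((A + 1) * (C + 1)) = (C + 1) * D"
    "(B + 1) * (C + 1) * ((A + 1) * (B + 1)) = (B + 1) * D"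
    "(A + 1) * (C + 1) * ((A + 1) * (B + 1)) = (A + 1) * D"
    by (simp_all add: D_def)
  have "(A - 1) * D + (B - 1) * D + (C - 1) * D + (C + 1) * D + (B + 1) * D + (A + 1) * D
      = 2 * (A + B + C) * D"
    by (simp add: algebra_simps)
  then have "moment_frame (level_frame q) = Q_point"
    unfolding lf moment_scaled_frame[OF assms tpos w] t N N' sum by (simp add: algebra_simps)
  then show thesis
    using that tpos lf by blast
qed

text \<open>The uniqueness half. The moment equations determine \<open>A\<close>, \<open>B\<close>, \<open>C\<close> and a root \<open>l\<close> of the scalar
  equation from the \<open>ti\<close>; since that root is unique, the scale factors of \<open>level_frame\<close> are those
  \<open>ti\<close> multiplied by one common constant \<open>k\<close>.\<close>

lemma span2_level_frame:
  assumes q: "q \<in> S3T2" and pos: "0 < t1" "0 < t2" "0 < t3" "0 < t4"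
    and Q: "moment_frame (scaled_frame t1 t2 t3 t4 q) = Q_point"
  shows "span2 (level_frame q) = span2 (scaled_frame t1 t2 t3 t4 q)"
proof -
  obtain x y z where w: "weight q = (x, y, z)" by (metis prod_cases3)
  have wt: "(x, y, z) \<in> nonzero_weights"
    using weight_nonzero[OF q] by (simp add: w)
  then have nn: "0 \<le> x" "0 \<le> y" "0 \<le> z" by (auto simp: nonzero_weights_def)
  define s1 s2 s3 s4 where "s1 = t1\<^sup>2" and "s2 = t2\<^sup>2" and "s3 = t3\<^sup>2" and "s4 = t4\<^sup>2"
  have spos: "0 < s1" "0 < s2" "0 < s3" "0 < s4"
    using pos by (simp_all add: s1_def s2_def s3_def s4_def)
  define D where "D = (x * (s1 * s2) + y * (s1 * s3) + z * (s1 * s4) + s2 * s3 + s2 * s4 + s3 * s4) / 18"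
  have eq: "s3 * s4 - x * (s1 * s2) = 2 * D" "s2 * s4 - y * (s1 * s3) = 2 * D"
    "s2 * s3 - z * (s1 * s4) = 2 * D"
    using Q unfolding moment_scaled_frame[OF q pos w]
    by (simp_all add: s1_def s2_def s3_def s4_def D_def)
  have D: "0 < D"
    unfolding D_def using nn spos by (simp add: add_nonneg_pos)
  define A B C where "A = s3 * s4 / D - 1" and "B = s2 * s4 / D - 1" and "C = s2 * s3 / D - 1"
  define l where "l = s1 * s2 * s3 * s4 / D\<^sup>2"
  have N: "x * (s1 * s2) = (A - 1) * D" "y * (s1 * s3) = (B - 1) * D" "z * (s1 * s4) = (C - 1) * D"
    using eq D by (simp_all add: A_def B_def C_def field_simps)
  have N': "s3 * s4 = (A + 1) * D" "s2 * s4 = (B + 1) * D" "s2 * s3 = (C + 1) * D"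
    using D by (simp_all add: A_def B_def C_def)
  have "18 * D = 2 * (A + B + C) * D"
    using D_def unfolding N N' by (simp add: algebra_simps)
  then have sum: "A + B + C = 9"
    using D by simp
  have ge: "0 \<le> (A - 1) * D" "0 \<le> (B - 1) * D" "0 \<le> (C - 1) * D"
    unfolding N[symmetric] using nn spos by simp_all
  then have ge: "1 \<le> A" "1 \<le> B" "1 \<le> C"
    using D by (simp_all add: zero_le_mult_iff)
  have "l * x = (s3 * s4) * (x * (s1 * s2)) / D\<^sup>2" "l * y = (s2 * s4) * (y * (s1 * s3)) / D\<^sup>2"
    "l * z = (s2 * s3) * (z * (s1 * s4)) / D\<^sup>2"
    by (simp_all add: l_def)
  then have "l * x = (A + 1) * (A - 1)" "l * y = (B + 1) * (B - 1)" "l * z = (C + 1) * (C - 1)"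
    unfolding N N' using D by (simp_all add: power2_eq_square)
  then have "1 + l * x = A\<^sup>2" "1 + l * y = B\<^sup>2" "1 + l * z = C\<^sup>2"
    by (simp_all add: power2_eq_square algebra_simps)
  then have sq: "sqrt (1 + l * x) = A" "sqrt (1 + l * y) = B" "sqrt (1 + l * z) = C"
    using ge by simp_all
  have "0 \<le> l"
    using spos by (simp add: l_def)
  then have l: "stretch (x, y, z) = l"
    using sum by (intro stretch_unique wt) (simp_all add: total_sqrt_def sq)
  \<comment> \<open>The common constant is forced by \<open>(B + 1) (C + 1) = k\<^sup>2 t2\<^sup>2\<close>.\<close>
  define k where "k = sqrt (s2 * s3 * s4) / D"
  have k: "0 < k" "k\<^sup>2 = s2 * s3 * s4 / D\<^sup>2"
    using spos D by (simp_all add: k_def power_divide)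
  have BC: "A + 1 = s3 * s4 / D" "B + 1 = s2 * s4 / D" "C + 1 = s2 * s3 / D"
    by (simp_all add: A_def B_def C_def)
  have "l = (k * t1)\<^sup>2" "(B + 1) * (C + 1) = (k * t2)\<^sup>2" "(A + 1) * (C + 1) = (k * t3)\<^sup>2"
    "(A + 1) * (B + 1) = (k * t4)\<^sup>2"
    unfolding BC power_mult_distrib k s1_def[symmetric] s2_def[symmetric] s3_def[symmetric] s4_def[symmetric]
    by (simp_all add: l_def power2_eq_square)
  then have t: "sqrt l = k * t1" "sqrt ((B + 1) * (C + 1)) = k * t2" "sqrt ((A + 1) * (C + 1)) = k * t3"
    "sqrt ((A + 1) * (B + 1)) = k * t4"
    using k pos by simp_all
  let ?p = "scaled_frame t1 t2 t3 t4 q"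
  have "level_frame q = scaled_frame (k * t1) (k * t2) (k * t3) (k * t4) q"
    by (simp add: level_frame_def w Let_def l sq t)
  also have "\<dots> = (of_real k *s fst ?p + 0 *s snd ?p, 0 *s fst ?p + of_real k *s snd ?p)"
    by (simp add: scaled_frame_def case_prod_unfold vec_eq_iff forall_4)
  also have "span2 \<dots> = span2 (fst ?p, snd ?p)"
    using k by (intro span2_change_basis) simp
  finally show ?thesis by simp
qed

section \<open>Continuity and the homeomorphism\<close>

lemma continuous_on_level_frame: "continuous_on S3T2 level_frame"
proof -
  have w: "continuous_on S3T2 weight"
    unfolding weight_def case_prod_unfold fst4_def snd4_def by (intro continuous_intros)
  have l: "continuous_on S3T2 (\<lambda>q. stretch (weight q))"
    by (rule continuous_on_compose2[OF continuous_on_stretch w]) (use weight_nonzero in blast)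
  show ?thesis
    unfolding level_frame_def Let_def scaled_frame_def case_prod_unfold fst4_def snd4_def
    by (intro continuous_intros w l)
qed

lemma continuous_on_plucker [continuous_intros]: "continuous_on S (plucker i j)"
  unfolding plucker_def by (intro continuous_intros)

lemma continuous_on_coords: "continuous_on generic_frames coords"
proof -
  have "real4 c d \<noteq> 0" if "c \<noteq> 0 \<or> d \<noteq> 0" for c d
    using that fst4_0 fst4_real4 by metis
  then show ?thesis
    unfolding coords_def Let_def
    by (intro continuous_intros ballI) (auto simp: generic_frames_def)
qed

lemma level_set42_span2:
  "{p \<in> frames42. span2 p \<in> level_set42 Q_point} = {p \<in> frames42. moment_frame p = Q_point}"
  by (auto simp: level_set42_def moment_map_span2 span2_in_G42)

text \<open>Closedness is what makes \<open>span2\<close> restrict to a quotient map onto the level set.\<close>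

lemma closedin_level_set42: "closedin grassmannian42 (level_set42 Q_point)"
proof -
  have "continuous_on frames42 moment_frame"
    unfolding moment_frame_def sum_pairs42
    by (intro continuous_intros) (use plucker_sum_pos in \<open>force simp: sum_pairs42\<close>)
  then have "closedin (top_of_set frames42) {p \<in> frames42. moment_frame p = Q_point}"
    by (simp add: continuous_closedin_preimage_constant)
  moreover have "level_set42 Q_point \<subseteq> topspace grassmannian42"
    by (auto simp: level_set42_def topspace_grassmannian42)
  moreover have "\<forall>U \<subseteq> topspace grassmannian42.
      closedin (top_of_set frames42) {p \<in> frames42. span2 p \<in> U} = closedin grassmannian42 U"
    using quotient_map_span2 by (simp add: quotient_map_closedin)
  ultimately show ?thesis
    by (metis (no_types) level_set42_span2)
qed

theorem theorem9:
  shows "subtopology grassmannian42 (level_set42 Q_point) homeomorphic_space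
    prod_topology (top_of_set (sphere (0 :: real^4) 1))
      (prod_topology (top_of_set (sphere (0 :: complex) 1)) (top_of_set (sphere (0 :: complex) 1)))"
proof -
  let ?F = "{p \<in> frames42. moment_frame p = Q_point}"
  let ?M = "subtopology grassmannian42 (level_set42 Q_point)"
  \<comment> \<open>The forward map is \<open>coords\<close> of an arbitrary frame of the plane.\<close>
  define frame_of where "frame_of L = (SOME p. p \<in> frames42 \<and> span2 p = L)" for L
  have frame_of: "frame_of L \<in> frames42" "span2 (frame_of L) = L" if "L \<in> G42" for L
  proof -
    have "\<exists>p. p \<in> frames42 \<and> span2 p = L"
      using that unfolding span2_image[symmetric] by auto
    from someI_ex[OF this] show "frame_of L \<in> frames42" "span2 (frame_of L) = L"
      by (simp_all add: frame_of_def)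
  qed
  have quot: "quotient_map (top_of_set ?F) ?M span2"
    using quotient_map_restriction[OF quotient_map_span2 _ disjI2[OF closedin_level_set42]]
    by (simp add: level_set42_span2 subtopology_subtopology Int_absorb1 Collect_restrict)
  have coords_frame_of: "coords (frame_of (span2 p)) = coords p" if "p \<in> frames42" for p
    using that coords_span2 frame_of span2_in_G42 by metis
  have F_generic: "?F \<subseteq> generic_frames"
    using level_imp_generic by blast
  have level: "level_frame q \<in> ?F" "coords (level_frame q) = q" if "q \<in> S3T2" for q
    using level_frame_scaled[OF that] scaled_frame_generic[OF that] coords_scaled_frame[OF that]
      generic_frames_subset
    by (smt (verit) mem_Collect_eq subsetD)+
  have "continuous_map (top_of_set ?F) (top_of_set S3T2) coords"
    using F_generic coords_in_S3T2 continuous_on_subset[OF continuous_on_coords]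
    by (auto simp: continuous_map_in_subtopology)
  then have "continuous_map (top_of_set ?F) (top_of_set S3T2) ((coords \<circ> frame_of) \<circ> span2)"
    by (rule continuous_map_eq) (simp add: coords_frame_of)
  then have 1: "continuous_map ?M (top_of_set S3T2) (coords \<circ> frame_of)"
    by (rule continuous_compose_quotient_map[OF quot])
  have "continuous_map (top_of_set S3T2) (top_of_set ?F) level_frame"
    using level continuous_on_level_frame by (auto simp: continuous_map_in_subtopology)
  then have 2: "continuous_map (top_of_set S3T2) ?M (span2 \<circ> level_frame)"
    by (rule continuous_map_compose[OF _ quotient_imp_continuous_map[OF quot]])
  have 3: "(span2 \<circ> level_frame) ((coords \<circ> frame_of) L) = L" if "L \<in> topspace ?M" for L
  proof -
    have L: "L \<in> G42" "moment_map L = Q_point"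
      using that by (auto simp: level_set42_def topspace_grassmannian42)
    define p where "p = frame_of L"
    have p: "p \<in> frames42" "span2 p = L" "moment_frame p = Q_point"
      using frame_of[OF L(1)] L(2) moment_map_span2[of p] by (simp_all add: p_def)
    then have gen: "p \<in> generic_frames"
      using level_imp_generic by blast
    then obtain t1 t2 t3 t4 where pos: "0 < t1" "0 < t2" "0 < t3" "0 < t4"
      and s: "span2 (scaled_frame t1 t2 t3 t4 (coords p)) = span2 p" (is "span2 ?f = _")
      by (rule generic_span2_eq_scaled_frame)
    have "?f \<in> generic_frames"
      using scaled_frame_generic[OF coords_in_S3T2[OF gen] pos] .
    then have "?f \<in> frames42"
      using generic_frames_subset by blast
    then have "moment_frame ?f = Q_point"
      using p s moment_map_span2 by metis
    then show ?thesis
      using span2_level_frame[OF coords_in_S3T2[OF gen] pos] s p by (simp add: p_def)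
  qed
  have 4: "(coords \<circ> frame_of) ((span2 \<circ> level_frame) q) = q" if "q \<in> S3T2" for q
    using level[OF that] coords_frame_of by simp
  have "homeomorphic_maps ?M (top_of_set S3T2) (coords \<circ> frame_of) (span2 \<circ> level_frame)"
    unfolding homeomorphic_maps_def using 1 2 3 4 by simp
  then have "?M homeomorphic_space top_of_set S3T2"
    unfolding homeomorphic_space_def by blast
  then show ?thesis
    by (simp add: S3T2_def)
qed

end
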